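(* Let $\mathcal{M} = (S, s_0, \Sigma_{\mathrm{in}}^1\times\Sigma_{\mathrm{in}}^2, \Sigma_{\mathrm{out}}, E, \Lambda)$ be a finite-state reactive system (FSRS), and let $\mathcal{M}' = (S', s_0', \Sigma_{\mathrm{in}}^1\times\Sigma_{\mathrm{in}}^2, \Sigma_{\mathrm{out}}, E', \Lambda')$ be an FSRS that abstracts $\mathcal{M}$. Let $\varphi \subseteq ((\Sigma_{\mathrm{in}}^1\times\Sigma_{\mathrm{in}}^2)\times\Sigma_{\mathrm{out}})^*$ be a specification realized by a safety automaton $\mathcal{A}^\varphi$, i.e. $\mathcal{L}(\mathcal{A}^\varphi)=\varphi$, and let $\mathcal{S}$ be the shield generated by $\mathcal{M}'$ and $\mathcal{A}^\varphi$. Then for every strategy $\tau$ of the environment in $\mathcal{M}$, the MDP $\mathcal{M}^\tau$ satisfies $\varphi$ under every controller strategy $\sigma$ generated by $\mathcal{S}$; that is, $\mathcal{L}(\mathcal{M}^{\sigma,\tau}) \subseteq \varphi$.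
   Context: For a set $X$, $\mathscr{D}X$ denotes the set of probability distributions over $X$. All state sets and alphabets are finite. **Mealy machines.** A Mealy machine is a tuple $(S, s_0, \Sigma_{\mathrm{in}}, \Sigma_{\mathrm{out}}, E, \Lambda)$ with finite state set $S$, initial state $s_0\in S$, finite input and output alphabets, a partial transition function $E\colon S\times\Sigma_{\mathrm{in}}\rightharpoonup S$ and a partial output function $\Lambda\colon S\times\Sigma_{\mathrm{in}}\rightharpoonup\Sigma_{\mathrm{out}}$, where $\Lambda(s,a)$ is defined iff $E(s,a)$ is defined. A run over $w=a_1\cdots a_n$ is the sequence $s_0,a_1,s_1,\dots,a_n,s_n$ with $E(s_{i-1},a_i)=s_i$ for all $i$. When it exists, $E(w):=s_n$ and, for $n\ge 1$, $\Lambda(w):=\Lambda(s_{n-1},a_n)$ (the last output). **FSRS.** An FSRS is a Mealy machine with $\Sigma_{\mathrm{in}}=\Sigma_{\mathrm{in}}^1\times\Sigma_{\mathrm{in}}^2$ (controller actions and environment actions, respectively) such that for each state $s$ and each $a^1\in\Sigma_{\mathrm{in}}^1$ there is $a^2\in\Sigma_{\mathrm{in}}^2$ for which $E(s,(a^1,a^2))$ is defined. **Abstraction.** $\mathcal{M}'$ abstracts $\mathcal{M}$ if for every $w\in(\Sigma_{\mathrm{in}}^1\times\Sigma_{\mathrm{in}}^2)^*$ such that $E(w)$ is defined, $E'(w)$ is also defined and $\Lambda(w)=\Lambda'(w)$ (the condition on outputs being imposed for nonempty $w$). **Strategies.** Let $\Pi_{\mathcal{M}}$ be the set of runs of $\mathcal{M}$.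 A controller strategy is a function $\sigma\colon\Pi_{\mathcal{M}}\to\mathscr{D}\Sigma_{\mathrm{in}}^1$. An environment strategy is a function $\tau\colon\Pi_{\mathcal{M}}\times\Sigma_{\mathrm{in}}^1\to\mathscr{D}\Sigma_{\mathrm{in}}^2$ such that $\tau(\rho,a^1)(\{a^2\})>0$ only if $E(\rho_{\mathrm{last}},(a^1,a^2))$ is defined, where $\rho_{\mathrm{last}}$ is the last state of $\rho$. Fixing $\tau$ turns $\mathcal{M}$ into an MDP $\mathcal{M}^\tau$ in which, after run $\rho$ and controller action $a^1$, the environment action is drawn from $\tau(\rho,a^1)$; fixing also $\sigma$ gives a purely stochastic structure $\mathcal{M}^{\sigma,\tau}$. Its language $\mathcal{L}(\mathcal{M}^{\sigma,\tau})\subseteq((\Sigma_{\mathrm{in}}^1\times\Sigma_{\mathrm{in}}^2)\times\Sigma_{\mathrm{out}})^*$ is the set of finite sequences $((a_1^1,a_1^2),b_1)\cdots((a_n^1,a_n^2),b_n)$, $n\ge 0$, of inputs and corresponding outputs along runs of $\mathcal{M}$ in which every controller action has positive probability under $\sigma$ and every environment action has positive probability under $\tau$ given the preceding run (and current controller action). $\mathcal{M}^\tau$ satisfies $\varphi$ under $\sigma$ if $\mathcal{L}(\mathcal{M}^{\sigma,\tau})\subseteq\varphi$. **Safety automata.** A safety automaton over a finite alphabet $\Sigma$ is $(Q,q_0,F,\Sigma,N)$ with finite state set $Q$, initial state $q_0$, safe states $F\subseteq Q$, and total transition function $N\colon Q\times\Sigma\to Q$ such that $N(q,a)\in F$ only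 if $q\in F$. Its language is the set of words whose unique run from $q_0$ ends in $F$. Here $\Sigma=(\Sigma_{\mathrm{in}}^1\times\Sigma_{\mathrm{in}}^2)\times\Sigma_{\mathrm{out}}$. **Safety game.** For $\mathcal{M}'$ and $\mathcal{A}^\varphi=(Q,q_0,F,\Sigma,N)$, the safety game $\mathcal{G}$ has states $G=(S'\cup\{s_\bot\})\times Q$ with $s_\bot$ a fresh sink, initial state $g_0=(s_0',q_0)$, and total transition function $E^G$: for $a=(a^1,a^2)$, $E^G((s,q),a)=(E'(s,a),\,N(q,(a,\Lambda'(s,a))))$ if $s\in S'$ and $E'(s,a)$ is defined, and otherwise $E^G((s,q),a)=(s_\bot,q)$. The good states are $F^G=(S'\times F)\cup(\{s_\bot\}\times Q)$. In each round, the controller chooses $a^1$, then the environment chooses $a^2$, and the game moves by $E^G$. A state $g$ is a safe (winning) state if the controller has a strategy such that, whatever the environment does, every state visited in every play from $g$ (including $g$) lies in $F^G$. **Shield.** The shield $\mathcal{S}$ generated by $\mathcal{M}'$ and $\mathcal{A}^\varphi$ is the Mealy machine with state set $G$, initial state $g_0$, inputs $\Sigma_{\mathrm{in}}^1\times\Sigma_{\mathrm{in}}^2$, outputs in $2^{\Sigma_{\mathrm{in}}^1}$, transition function $E^G$, and whose output at state $g$ (independent of the input action) is the set of permitted actions $$\Lambda_{\mathcal{S}}(g)=\{a^1\in\Sigma_{\mathrm{in}}^1 \mid E^G(g,(a^1,a^2)) \text{ is a safe (winning) state for every } a^2\in\Sigma_{\mathrm{in}}^2\}.$$ For an input word $w$,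 let $\Lambda_{\mathcal{S}}(w)$ be the set of permitted actions at the state reached from $g_0$ by reading $w$. **Strategy generated by the shield.** A controller strategy $\sigma$ of $\mathcal{M}$ is generated by $\mathcal{S}$ if for every run $\rho$ of $\mathcal{M}$, over input word $w$, in which each controller action has positive probability under $\sigma$ given the preceding run, the distribution $\sigma(\rho)$ is supported in $\Lambda_{\mathcal{S}}(w)$. *)

theory Defs
  imports "HOL-Probability.Probability_Mass_Function"
begin

text \<open>
  State sets and alphabets are types; their finiteness is expressed by the type class
  \<^class>\<open>finite\<close>. Partial functions take values in an option type.
\<close>

section \<open>Mealy machines\<close>

record ('s, 'i, 'o) mealy =
  init :: 's
  trans :: "'s \<Rightarrow> 'i \<Rightarrow> 's option"
  outp :: "'s \<Rightarrow> 'i \<Rightarrow> 'o option"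

definition mealy_machine :: "('s, 'i, 'o) mealy \<Rightarrow> bool" where
  "mealy_machine M \<longleftrightarrow> (\<forall>s a. outp M s a \<noteq> None \<longleftrightarrow> trans M s a \<noteq> None)"

fun trans_from :: "('s, 'i, 'o) mealy \<Rightarrow> 's \<Rightarrow> 'i list \<Rightarrow> 's option" where
  "trans_from M s [] = Some s"
| "trans_from M s (a # w) =
    (case trans M s a of None \<Rightarrow> None | Some s' \<Rightarrow> trans_from M s' w)"

definition trans_word :: "('s, 'i, 'o) mealy \<Rightarrow> 'i list \<Rightarrow> 's option" where
  "trans_word M w = trans_from M (init M) w"

text \<open>The last output on a word; only meaningful for nonempty words.\<close>

definition outp_word :: "('s, 'i, 'o) mealy \<Rightarrow> 'i list \<Rightarrow> 'o option" where
  "outp_word M w =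
    (case trans_word M (butlast w) of None \<Rightarrow> None | Some s \<Rightarrow> outp M s (last w))"

text \<open>
  The alternating sequence \<open>s\<^sub>0, a\<^sub>1, s\<^sub>1, \<dots>, a\<^sub>n, s\<^sub>n\<close> is encoded as
  \<open>(s\<^sub>0, [(a\<^sub>1, s\<^sub>1), \<dots>, (a\<^sub>n, s\<^sub>n)])\<close>.
\<close>

type_synonym ('s, 'i) run = "'s \<times> ('i \<times> 's) list"

fun steps_ok :: "('s, 'i, 'o) mealy \<Rightarrow> 's \<Rightarrow> ('i \<times> 's) list \<Rightarrow> bool" where
  "steps_ok M s [] \<longleftrightarrow> True"
| "steps_ok M s ((a, s') # xs) \<longleftrightarrow> trans M s a = Some s' \<and> steps_ok M s' xs"

definition runs :: "('s, 'i, 'o) mealy \<Rightarrow> ('s, 'i) run set" where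
  "runs M = {(s, xs). s = init M \<and> steps_ok M s xs}"

definition last_state :: "('s, 'i) run \<Rightarrow> 's" where
  "last_state \<rho> = (if snd \<rho> = [] then fst \<rho> else snd (last (snd \<rho>)))"

definition input_word :: "('s, 'i) run \<Rightarrow> 'i list" where
  "input_word \<rho> = map fst (snd \<rho>)"

definition run_length :: "('s, 'i) run \<Rightarrow> nat" where
  "run_length \<rho> = length (snd \<rho>)"

definition run_prefix :: "nat \<Rightarrow> ('s, 'i) run \<Rightarrow> ('s, 'i) run" where
  "run_prefix n \<rho> = (fst \<rho>, take n (snd \<rho>))"

text \<open>The inputs with their outputs along a run. On runs of a Mealy machine the
  output taken with \<^const>\<open>the\<close> is always defined.\<close>

fun trace_from :: "('s, 'i, 'o) mealy \<Rightarrow> 's \<Rightarrow> ('i \<times> 's) list \<Rightarrow> ('i \<times> 'o) list" where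
  "trace_from M s [] = []"
| "trace_from M s ((a, s') # xs) = (a, the (outp M s a)) # trace_from M s' xs"

definition trace :: "('s, 'i, 'o) mealy \<Rightarrow> ('s, 'i) run \<Rightarrow> ('i \<times> 'o) list" where
  "trace M \<rho> = trace_from M (fst \<rho>) (snd \<rho>)"

section \<open>Finite-state reactive systems\<close>

definition fsrs :: "('s, 'i1 \<times> 'i2, 'o) mealy \<Rightarrow> bool" where
  "fsrs M \<longleftrightarrow> mealy_machine M \<and> (\<forall>s a1. \<exists>a2. trans M s (a1, a2) \<noteq> None)"

definition abstracts ::
  "('t, 'i1 \<times> 'i2, 'o) mealy \<Rightarrow> ('s, 'i1 \<times> 'i2, 'o) mealy \<Rightarrow> bool" where
  "abstracts M' M \<longleftrightarrow>
    (\<forall>w. trans_word M w \<noteq> None \<longrightarrow>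
      trans_word M' w \<noteq> None \<and> (w \<noteq> [] \<longrightarrow> outp_word M w = outp_word M' w))"

section \<open>Strategies\<close>

text \<open>
  Strategies are functions on runs of \<open>M\<close>; being total functions in HOL, they also have
  values outside \<^term>\<open>runs M\<close>, which are unconstrained and never used.
  Every function of type \<open>controller_strategy\<close> is a controller strategy.
\<close>

type_synonym ('s, 'i1, 'i2) controller_strategy = "('s, 'i1 \<times> 'i2) run \<Rightarrow> 'i1 pmf"

type_synonym ('s, 'i1, 'i2) env_strategy = "('s, 'i1 \<times> 'i2) run \<Rightarrow> 'i1 \<Rightarrow> 'i2 pmf"

definition environment_strategy ::
  "('s, 'i1 \<times> 'i2, 'o) mealy \<Rightarrow> ('s, 'i1, 'i2) env_strategy \<Rightarrow> bool" where
  "environment_strategy M \<tau> \<longleftrightarrow>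
    (\<forall>\<rho>\<in>runs M. \<forall>a1 a2.
      pmf (\<tau> \<rho> a1) a2 > 0 \<longrightarrow> trans M (last_state \<rho>) (a1, a2) \<noteq> None)"

definition controller_positive ::
  "('s, 'i1, 'i2) controller_strategy \<Rightarrow> ('s, 'i1 \<times> 'i2) run \<Rightarrow> bool" where
  "controller_positive \<sigma> \<rho> \<longleftrightarrow>
    (\<forall>k<run_length \<rho>. pmf (\<sigma> (run_prefix k \<rho>)) (fst (input_word \<rho> ! k)) > 0)"

definition environment_positive ::
  "('s, 'i1, 'i2) env_strategy \<Rightarrow> ('s, 'i1 \<times> 'i2) run \<Rightarrow> bool" where
  "environment_positive \<tau> \<rho> \<longleftrightarrow>
    (\<forall>k<run_length \<rho>.
      pmf (\<tau> (run_prefix k \<rho>) (fst (input_word \<rho> ! k))) (snd (input_word \<rho> ! k)) > 0)"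

text \<open>The language of the stochastic structure obtained from \<open>M\<close> by fixing both strategies.\<close>

definition language ::
  "('s, 'i1 \<times> 'i2, 'o) mealy \<Rightarrow> ('s, 'i1, 'i2) controller_strategy \<Rightarrow>
    ('s, 'i1, 'i2) env_strategy \<Rightarrow> (('i1 \<times> 'i2) \<times> 'o) list set" where
  "language M \<sigma> \<tau> =
    {trace M \<rho> | \<rho>. \<rho> \<in> runs M \<and> controller_positive \<sigma> \<rho> \<and> environment_positive \<tau> \<rho>}"

text \<open>The MDP obtained from \<open>M\<close> by fixing \<open>\<tau>\<close> satisfies \<open>\<phi>\<close> under \<open>\<sigma>\<close>.\<close>

definition mdp_satisfies ::
  "('s, 'i1 \<times> 'i2, 'o) mealy \<Rightarrow> ('s, 'i1, 'i2) env_strategy \<Rightarrow>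
    ('s, 'i1, 'i2) controller_strategy \<Rightarrow> (('i1 \<times> 'i2) \<times> 'o) list set \<Rightarrow> bool" where
  "mdp_satisfies M \<tau> \<sigma> \<phi> \<longleftrightarrow> language M \<sigma> \<tau> \<subseteq> \<phi>"

section \<open>Safety automata\<close>

record ('q, 'a) dfa =
  dfa_init :: 'q
  dfa_safe :: "'q set"
  dfa_next :: "'q \<Rightarrow> 'a \<Rightarrow> 'q"

definition safety_automaton :: "('q, 'a) dfa \<Rightarrow> bool" where
  "safety_automaton A \<longleftrightarrow> (\<forall>q a. dfa_next A q a \<in> dfa_safe A \<longrightarrow> q \<in> dfa_safe A)"

definition dfa_language :: "('q, 'a) dfa \<Rightarrow> 'a list set" where
  "dfa_language A = {w. foldl (dfa_next A) (dfa_init A) w \<in> dfa_safe A}"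

section \<open>Safety games\<close>

record ('g, 'i1, 'i2) game =
  game_init :: 'g
  game_next :: "'g \<Rightarrow> 'i1 \<times> 'i2 \<Rightarrow> 'g"
  game_good :: "'g set"

text \<open>
  An infinite play consists of the visited states \<open>\<pi> 0, \<pi> 1, \<dots>\<close> and the chosen action pairs
  \<open>\<alpha> 0, \<alpha> 1, \<dots>\<close>. A strategy of the controller in the game maps the history of a play to the
  next controller action.
\<close>

definition play :: "('g, 'i1, 'i2) game \<Rightarrow> 'g \<Rightarrow> (nat \<Rightarrow> 'g) \<Rightarrow> (nat \<Rightarrow> 'i1 \<times> 'i2) \<Rightarrow> bool" where
  "play G g \<pi> \<alpha> \<longleftrightarrow> \<pi> 0 = g \<and> (\<forall>n. \<pi> (Suc n) = game_next G (\<pi> n) (\<alpha> n))"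

definition history :: "(nat \<Rightarrow> 'g) \<Rightarrow> (nat \<Rightarrow> 'a) \<Rightarrow> nat \<Rightarrow> ('g, 'a) run" where
  "history \<pi> \<alpha> n = (\<pi> 0, map (\<lambda>k. (\<alpha> k, \<pi> (Suc k))) [0..<n])"

definition winning :: "('g, 'i1, 'i2) game \<Rightarrow> 'g \<Rightarrow> bool" where
  "winning G g \<longleftrightarrow>
    (\<exists>f :: ('g, 'i1 \<times> 'i2) run \<Rightarrow> 'i1.
      \<forall>\<pi> \<alpha>. play G g \<pi> \<alpha> \<and> (\<forall>n. fst (\<alpha> n) = f (history \<pi> \<alpha> n)) \<longrightarrow>
        (\<forall>n. \<pi> n \<in> game_good G))"

text \<open>In the safety game, \<^const>\<open>None\<close> is the fresh sink \<open>s\<^sub>\<bottom>\<close>.\<close>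

fun safety_game_next ::
  "('t, 'i1 \<times> 'i2, 'o) mealy \<Rightarrow> ('q, ('i1 \<times> 'i2) \<times> 'o) dfa \<Rightarrow>
    't option \<times> 'q \<Rightarrow> 'i1 \<times> 'i2 \<Rightarrow> 't option \<times> 'q" where
  "safety_game_next M' A (Some s, q) a =
    (case trans M' s a of
      Some s' \<Rightarrow> (Some s', dfa_next A q (a, the (outp M' s a)))
    | None \<Rightarrow> (None, q))"
| "safety_game_next M' A (None, q) a = (None, q)"

definition safety_game ::
  "('t, 'i1 \<times> 'i2, 'o) mealy \<Rightarrow> ('q, ('i1 \<times> 'i2) \<times> 'o) dfa \<Rightarrow>
    ('t option \<times> 'q, 'i1, 'i2) game" where
  "safety_game M' A =
    \<lparr>game_init = (Some (init M'), dfa_init A),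
     game_next = safety_game_next M' A,
     game_good = range Some \<times> dfa_safe A \<union> {None} \<times> UNIV\<rparr>"

section \<open>Shields\<close>

definition permitted :: "('g, 'i1, 'i2) game \<Rightarrow> 'g \<Rightarrow> 'i1 set" where
  "permitted G g = {a1. \<forall>a2. winning G (game_next G g (a1, a2))}"

definition shield ::
  "('t, 'i1 \<times> 'i2, 'o) mealy \<Rightarrow> ('q, ('i1 \<times> 'i2) \<times> 'o) dfa \<Rightarrow>
    ('t option \<times> 'q, 'i1 \<times> 'i2, 'i1 set) mealy" where
  "shield M' A =
    (let G = safety_game M' A in
      \<lparr>init = game_init G,
       trans = (\<lambda>g a. Some (game_next G g a)),
       outp = (\<lambda>g a. Some (permitted G g))\<rparr>)"

text \<open>
  The permitted actions at the state reached by a word: since the output of a shield does not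
  depend on the input, it is the common output \<open>X\<close> of that state on all inputs.
\<close>

definition permitted_after ::
  "('g, 'i1 \<times> 'i2, 'i1 set) mealy \<Rightarrow> ('i1 \<times> 'i2) list \<Rightarrow> 'i1 set" where
  "permitted_after S w =
    {a1. \<exists>g X. trans_word S w = Some g \<and> (\<forall>a. outp S g a = Some X) \<and> a1 \<in> X}"

lemma permitted_after_shield:
  "permitted_after (shield M' A) w =
    permitted (safety_game M' A)
      (foldl (game_next (safety_game M' A)) (game_init (safety_game M' A)) w)"
proof -
  have "trans_from (shield M' A) g w = Some (foldl (game_next (safety_game M' A)) g w)" for g
    by (induction w arbitrary: g) (simp_all add: shield_def Let_def)
  then show ?thesis
    by (simp add: permitted_after_def trans_word_def) (simp add: shield_def Let_def)
qed

definition generated_by ::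
  "('s, 'i1 \<times> 'i2, 'o) mealy \<Rightarrow> ('g, 'i1 \<times> 'i2, 'i1 set) mealy \<Rightarrow>
    ('s, 'i1, 'i2) controller_strategy \<Rightarrow> bool" where
  "generated_by M S \<sigma> \<longleftrightarrow>
    (\<forall>\<rho>\<in>runs M. controller_positive \<sigma> \<rho> \<longrightarrow>
      set_pmf (\<sigma> \<rho>) \<subseteq> permitted_after S (input_word \<rho>))"

end

theory Submission imports Defs begin

text \<open>
  Every distribution has nonempty support, so after each run that is possible under \<open>\<sigma>\<close> the shield
  permits some action \<open>a\<^sup>1\<close>. As the abstraction is an FSRS, it has a transition on \<open>(a\<^sup>1, a\<^sup>2)\<close> for
  some \<open>a\<^sup>2\<close>, and the game state reached by it is winning, hence good and not the sink. Its automaton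
  component is thus safe, and safety propagates back to the state reached by the trace of the run.
  Arguing with the next step instead of the last one covers the empty trace as well.
\<close>

lemma trans_from_init_update [simp]: "trans_from (M\<lparr>init := s\<rparr>) s' w = trans_from M s' w"
  by (induction w arbitrary: s') (simp_all split: option.splits)

text \<open>Overriding \<open>init\<close> turns abstraction, a condition on words read from the
  initial state, into a relation between arbitrary states \<open>t\<close> and \<open>s\<close>. The
  word \<open>[a]\<close> gives the matching transition and output, the words \<open>a # w\<close>
  the relation at the successors.\<close>

lemma abstracts_step:
  assumes "abstracts (M'\<lparr>init := t\<rparr>) (M\<lparr>init := s\<rparr>)" and "trans M s a = Some s1"
  obtains t1 where "trans M' t a = Some t1" "outp M s a = outp M' t a"
    "abstracts (M'\<lparr>init := t1\<rparr>) (M\<lparr>init := s1\<rparr>)"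
proof -
  have abs: "trans_from M' t w \<noteq> None \<and>
      (w \<noteq> [] \<longrightarrow> outp_word (M\<lparr>init := s\<rparr>) w = outp_word (M'\<lparr>init := t\<rparr>) w)"
    if "trans_from M s w \<noteq> None" for w
    using assms(1) that unfolding abstracts_def trans_word_def by simp
  obtain t1 where t1: "trans M' t a = Some t1"
    using abs[of "[a]"] assms(2) by (auto split: option.splits)
  have out: "outp M s a = outp M' t a"
    using abs[of "[a]"] assms(2) by (simp add: outp_word_def trans_word_def)
  have "abstracts (M'\<lparr>init := t1\<rparr>) (M\<lparr>init := s1\<rparr>)"
    unfolding abstracts_def
  proof (intro allI impI)
    fix w
    assume "trans_word (M\<lparr>init := s1\<rparr>) w \<noteq> None"
    then show "trans_word (M'\<lparr>init := t1\<rparr>) w \<noteq> None \<and>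
        (w \<noteq> [] \<longrightarrow> outp_word (M\<lparr>init := s1\<rparr>) w = outp_word (M'\<lparr>init := t1\<rparr>) w)"
      \<comment> \<open>For nonempty \<open>w\<close>, the words \<open>a # w\<close> and
        \<open>w\<close> have the same last letter, and \<open>butlast\<close> keeps the leading
        \<open>a\<close>, so the last outputs agree.\<close>
      using abs[of "a # w"] assms(2) t1 by (auto simp: outp_word_def trans_word_def cong: option.case_cong)
  qed
  with t1 out that show thesis by blast
qed

text \<open>Along a run of \<open>M\<close> the abstraction follows every step with the same output.
  So the game stays out of the sink, and its automaton component reads exactly the trace of
  \<open>M\<close>.\<close>

lemma safety_game_simulates:
  assumes "abstracts (M'\<lparr>init := t\<rparr>) (M\<lparr>init := s\<rparr>)" and "steps_ok M s xs"
  obtains t' where "foldl (safety_game_next M' A) (Some t, q) (map fst xs) =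
    (Some t', foldl (dfa_next A) q (trace_from M s xs))"
  using assms
proof (induction xs arbitrary: s t q thesis)
  case Nil
  then show ?case by simp
next
  case (Cons x xs)
  obtain a s1 where x: "x = (a, s1)" by (cases x)
  from Cons.prems(3) x have step: "trans M s a = Some s1" and ok: "steps_ok M s1 xs" by simp_all
  obtain t1 where t1: "trans M' t a = Some t1" "outp M s a = outp M' t a"
    and abs: "abstracts (M'\<lparr>init := t1\<rparr>) (M\<lparr>init := s1\<rparr>)"
    using abstracts_step[OF Cons.prems(2) step] .
  show ?case
    by (rule Cons.IH[OF _ abs ok, of "dfa_next A q (a, the (outp M s a))"])
      (use Cons.prems(1) x t1 in simp)
qed

text \<open>Winning speaks of all plays consistent with a strategy, so it yields information only
  once such a play is known to exist.\<close>

lemma play_consistent_exists: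
  fixes G :: "('g, 'i1, 'i2) game"
  obtains \<pi> \<alpha> where "play G g \<pi> \<alpha>" "\<And>n. fst (\<alpha> n) = f (history \<pi> \<alpha> n)"
proof -
  \<comment> \<open>Histories are iterated first, and states and actions are read off from them,
    because \<open>f\<close> needs the whole history. Any environment action would do;
    \<open>undefined\<close> is an arbitrary one.\<close>
  define ext where "ext r = (fst r, snd r @
    [((f r, undefined), game_next G (last_state r) (f r, undefined))])" for r
  define r where "r n = (ext ^^ n) (g, [])" for n
  define \<pi> where "\<pi> n = last_state (r n)" for n
  define \<alpha> where "\<alpha> n = (f (r n), undefined :: 'i2)" for n
  have r_Suc: "r (Suc n) = ext (r n)" for n by (simp add: r_def)
  have \<pi>0: "\<pi> 0 = g" by (simp add: \<pi>_def r_def last_state_def)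
  have \<pi>_Suc: "\<pi> (Suc n) = game_next G (\<pi> n) (\<alpha> n)" for n
    by (simp add: \<pi>_def r_Suc \<alpha>_def) (simp add: ext_def last_state_def)
  have "history \<pi> \<alpha> n = r n" for n
  proof (induction n)
    case 0
    then show ?case by (simp add: history_def \<pi>0 r_def)
  next
    case (Suc n)
    have hist: "history \<pi> \<alpha> (Suc n) =
        (fst (history \<pi> \<alpha> n), snd (history \<pi> \<alpha> n) @ [(\<alpha> n, \<pi> (Suc n))])"
      by (simp add: history_def)
    show ?case
      unfolding hist Suc r_Suc \<pi>_Suc ext_def by (simp add: \<alpha>_def \<pi>_def)
  qed
  then have "fst (\<alpha> n) = f (history \<pi> \<alpha> n)" for n by (simp add: \<alpha>_def)
  moreover have "play G g \<pi> \<alpha>" using \<pi>0 \<pi>_Suc by (simp add: play_def)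
  ultimately show thesis using that by blast
qed

lemma winning_imp_good:
  assumes "winning G g"
  shows "g \<in> game_good G"
proof -
  obtain f where f: "\<And>\<pi> \<alpha> n. play G g \<pi> \<alpha> \<Longrightarrow> (\<And>n. fst (\<alpha> n) = f (history \<pi> \<alpha> n)) \<Longrightarrow>
      \<pi> n \<in> game_good G"
    using assms unfolding winning_def by blast
  obtain \<pi> \<alpha> where p: "play G g \<pi> \<alpha>" "\<And>n. fst (\<alpha> n) = f (history \<pi> \<alpha> n)"
    by (rule play_consistent_exists[of G g f]) blast
  have "\<pi> 0 \<in> game_good G" by (rule f[OF p])
  with p(1) show ?thesis by (simp add: play_def)
qed

lemma safe_if_permitted:
  assumes "fsrs M'" and "safety_automaton A"
    and "a1 \<in> permitted (safety_game M' A) (Some t, q)"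
  shows "q \<in> dfa_safe A"
proof -
  obtain a2 t' where t': "trans M' t (a1, a2) = Some t'"
    using assms(1) unfolding fsrs_def by blast
  have "game_next (safety_game M' A) (Some t, q) (a1, a2) \<in> game_good (safety_game M' A)"
    using assms(3) by (intro winning_imp_good) (simp add: permitted_def)
  then have "dfa_next A q ((a1, a2), the (outp M' t (a1, a2))) \<in> dfa_safe A"
    using t' by (simp add: safety_game_def)
  then show ?thesis using assms(2) by (auto simp: safety_automaton_def)
qed

theorem theorem13:
  fixes M :: "('s :: finite, 'i1 :: finite \<times> 'i2 :: finite, 'o :: finite) mealy"
    and M' :: "('t :: finite, 'i1 \<times> 'i2, 'o) mealy"
    and A :: "('q :: finite, ('i1 \<times> 'i2) \<times> 'o) dfa"
    and \<phi> :: "(('i1 \<times> 'i2) \<times> 'o) list set"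
  assumes "fsrs M"
    and "fsrs M'"
    and "abstracts M' M"
    and "safety_automaton A"
    and "dfa_language A = \<phi>"
  shows "\<forall>\<tau>. environment_strategy M \<tau> \<longrightarrow>
           (\<forall>\<sigma>. generated_by M (shield M' A) \<sigma> \<longrightarrow> mdp_satisfies M \<tau> \<sigma> \<phi>)"
proof -
  have "trace M \<rho> \<in> dfa_language A"
    if gen: "generated_by M (shield M' A) \<sigma>" and run: "\<rho> \<in> runs M"
      and pos: "controller_positive \<sigma> \<rho>" for \<sigma> \<rho>
  proof -
    obtain xs where \<rho>: "\<rho> = (init M, xs)" and ok: "steps_ok M (init M) xs"
      using run by (auto simp: runs_def)
    \<comment> \<open>These updates change nothing; they put the hypothesis into the form that the
      simulation expects.\<close>
    have abs: "abstracts (M'\<lparr>init := init M'\<rparr>) (M\<lparr>init := init M\<rparr>)"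
      using assms(3) by simp
    obtain t' where t': "foldl (safety_game_next M' A) (Some (init M'), dfa_init A) (map fst xs) =
        (Some t', foldl (dfa_next A) (dfa_init A) (trace M \<rho>))"
      unfolding trace_def \<rho> fst_conv snd_conv
      using safety_game_simulates[OF abs ok, where A = A and q = "dfa_init A"] .
    obtain a1 where "a1 \<in> set_pmf (\<sigma> \<rho>)"
      using set_pmf_not_empty by fast
    then have "a1 \<in> permitted_after (shield M' A) (input_word \<rho>)"
      using gen run pos unfolding generated_by_def by blast
    then have "a1 \<in> permitted (safety_game M' A)
        (Some t', foldl (dfa_next A) (dfa_init A) (trace M \<rho>))"
      unfolding permitted_after_shield using t' by (simp add: safety_game_def input_word_def \<rho>)
    from safe_if_permitted[OF assms(2,4) this] show ?thesis by (simp add: dfa_language_def)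
  qed
  then show ?thesis
    unfolding mdp_satisfies_def language_def assms(5) by blast
qed

end
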